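(* Let $D$ be a non-zero $n\times n$ generalized Euclidean distance matrix. Then $\rho(D)\le\rho\!\left(\frac{D+D'}{2}\right)$.
   Context: All matrices are real; a prime denotes transpose and $\rho(\cdot)$ denotes spectral radius. $\mathbf{1}\in\mathbb{R}^n$ is the vector of all ones. An $n\times n$ real symmetric matrix $L$ is a generalized Laplacian matrix if $L$ is positive semidefinite and $L\mathbf{1}=0$. An $n\times n$ matrix $D=[d_{ij}]$ is a generalized Euclidean distance matrix if there exist real numbers $a,b>0$ and an $n\times n$ generalized Laplacian matrix $L=[l_{ij}]$ such that $d_{ij}=a^2 l_{ii}+b^2 l_{jj}-2ab\,l_{ij}$ for all $i,j$. *)

theory Defs
  imports "Jordan_Normal_Form.Spectral_Radius"
begin

definition pos_semidef_mat :: "nat \<Rightarrow> real mat \<Rightarrow> bool" where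
  "pos_semidef_mat n A \<longleftrightarrow>
     A \<in> carrier_mat n n \<and> (\<forall>x \<in> carrier_vec n. 0 \<le> x \<bullet> (A *\<^sub>v x))"

definition generalized_laplacian :: "nat \<Rightarrow> real mat \<Rightarrow> bool" where
  "generalized_laplacian n L \<longleftrightarrow>
     L \<in> carrier_mat n n \<and> transpose_mat L = L \<and> pos_semidef_mat n L \<and>
     L *\<^sub>v vec n (\<lambda>_. 1) = 0\<^sub>v n"

definition generalized_EDM :: "nat \<Rightarrow> real mat \<Rightarrow> bool" where
  "generalized_EDM n D \<longleftrightarrow>
     D \<in> carrier_mat n n \<and>
     (\<exists>a b L. a > 0 \<and> b > 0 \<and> generalized_laplacian n L \<and>
        (\<forall>i < n. \<forall>j < n.
           D $$ (i, j) = a\<^sup>2 * L $$ (i, i) + b\<^sup>2 * L $$ (j, j) - 2 * a * b * L $$ (i, j)))"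

text \<open>The eigenvalues of a real matrix are taken over the complex numbers, since a real
  matrix that is not symmetric may have non-real eigenvalues.\<close>

definition real_spectral_radius :: "real mat \<Rightarrow> real" where
  "real_spectral_radius A = spectral_radius (map_mat complex_of_real A)"

end

theory Submission
  imports Defs "HOL-Analysis.L2_Norm"
begin

text \<open>A generalized Euclidean distance matrix is entrywise nonnegative, because its entries are
  values of the quadratic form of \<open>L\<close> at the vectors \<open>a e\<^sub>i - b e\<^sub>j\<close>. For an eigenpair \<open>(e, z)\<close> of a
  nonnegative matrix \<open>A\<close> with symmetric part \<open>S\<close>, the entrywise absolute value \<open>y\<close> of \<open>z\<close> satisfies
  \<open>|e| y'y \<le> y'Ay = y'Sy\<close>. It remains to bound the Rayleigh quotient of a symmetric \<open>S\<close> by its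
  spectral radius. If \<open>c\<close> exceeds the spectral radius, the powers of \<open>T = S / c\<close> are bounded; on the
  other hand the Cauchy--Schwarz inequality gives \<open>(x'Tx / x'x)\<^bsup>2^k\<^esup> \<le> x'T\<^bsup>2^k\<^esup>x / x'x\<close>, so that
  \<open>x'Tx \<le> x'x\<close>.\<close>

section \<open>Powers of symmetric matrices\<close>

lemma pow_mat_add:
  fixes A :: "'a :: semiring_1 mat"
  assumes A: "A \<in> carrier_mat n n"
  shows "A ^\<^sub>m (i + j) = A ^\<^sub>m i * A ^\<^sub>m j"
proof (induction j)
  case 0
  then show ?case using A by simp
next
  case (Suc j)
  then show ?case
    using A by (simp add: assoc_mult_mat[of _ n n _ n _ n])
qed

lemma transpose_pow_mat_symmetric:
  fixes A :: "'a :: comm_semiring_1 mat"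
  assumes A: "A \<in> carrier_mat n n" and sym: "transpose_mat A = A"
  shows "transpose_mat (A ^\<^sub>m k) = A ^\<^sub>m k"
proof (induction k)
  case 0
  then show ?case by simp
next
  case (Suc k)
  \<comment> \<open>Powers grow by a factor on the right, which transposition moves to the left.
    Written as a first power, it can be moved back by \<open>pow_mat_add\<close>.\<close>
  have "transpose_mat (A ^\<^sub>m Suc k) = A ^\<^sub>m 1 * A ^\<^sub>m k"
    using A Suc sym by (simp add: transpose_mult[of _ n n _ n])
  also have "\<dots> = A ^\<^sub>m Suc k"
    unfolding pow_mat_add[OF A, symmetric] by simp
  finally show ?case .
qed

section \<open>Cauchy-Schwarz and growth of quadratic forms under powers\<close>

lemma scalar_prod_self_nonneg: "0 \<le> x \<bullet> (x :: real vec)"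
  by (simp add: scalar_prod_def sum_nonneg)

lemma scalar_prod_Cauchy_Schwarz:
  fixes x y :: "real vec"
  assumes "x \<in> carrier_vec n" and "y \<in> carrier_vec n"
  shows "(x \<bullet> y)\<^sup>2 \<le> (x \<bullet> x) * (y \<bullet> y)"
proof -
  let ?L = "\<lambda>v :: real vec. L2_set (\<lambda>i. v $ i) {0..<n}"
  have L: "(?L v)\<^sup>2 = v \<bullet> v" if "v \<in> carrier_vec n" for v
    using that by (simp add: L2_set_def scalar_prod_def sum_nonneg power2_eq_square)
  have "\<bar>x \<bullet> y\<bar> \<le> (\<Sum>i\<in>{0..<n}. \<bar>x $ i\<bar> * \<bar>y $ i\<bar>)"
    using assms sum_abs[of "\<lambda>i. x $ i * y $ i" "{0..<n}"]
    by (simp add: scalar_prod_def abs_mult)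
  also have "\<dots> \<le> ?L x * ?L y"
    by (rule L2_set_mult_ineq)
  finally have "\<bar>x \<bullet> y\<bar>\<^sup>2 \<le> (?L x * ?L y)\<^sup>2"
    by (intro power_mono) auto
  then show ?thesis
    using assms by (simp add: power_mult_distrib L)
qed

text \<open>The right-hand side involves the matrix only through \<open>K\<close>, so a single bound
  serves all powers of a matrix at once.\<close>

lemma quadratic_form_bound:
  fixes x :: "real vec"
  assumes A: "A \<in> carrier_mat n n" and x: "x \<in> carrier_vec n"
    and K: "\<And>i j. i < n \<Longrightarrow> j < n \<Longrightarrow> \<bar>A $$ (i, j)\<bar> \<le> K"
  shows "x \<bullet> (A *\<^sub>v x) \<le> (\<Sum>i\<in>{0..<n}. \<Sum>j\<in>{0..<n}. \<bar>x $ i\<bar> * (K * \<bar>x $ j\<bar>))"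
proof -
  have "x \<bullet> (A *\<^sub>v x) = (\<Sum>i\<in>{0..<n}. \<Sum>j\<in>{0..<n}. x $ i * (A $$ (i, j) * x $ j))"
    using A x by (simp add: scalar_prod_def sum_distrib_left)
  also have "\<dots> \<le> (\<Sum>i\<in>{0..<n}. \<Sum>j\<in>{0..<n}. \<bar>x $ i\<bar> * (K * \<bar>x $ j\<bar>))"
  proof (intro sum_mono)
    fix i j assume "i \<in> {0..<n}" "j \<in> {0..<n}"
    then have "\<bar>x $ i\<bar> * (\<bar>A $$ (i, j)\<bar> * \<bar>x $ j\<bar>) \<le> \<bar>x $ i\<bar> * (K * \<bar>x $ j\<bar>)"
      using K by (intro mult_left_mono mult_right_mono) auto
    then show "x $ i * (A $$ (i, j) * x $ j) \<le> \<bar>x $ i\<bar> * (K * \<bar>x $ j\<bar>)"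
      using abs_ge_self[of "x $ i * (A $$ (i, j) * x $ j)"] by (simp add: abs_mult)
  qed
  finally show ?thesis .
qed

text \<open>Each doubling of the exponent squares the factor: the power \<open>B\<close> is
  symmetric, so x'BBx = (Bx)'(Bx), and Cauchy-Schwarz bounds (x'Bx)^2 by (x'x) times this. Since r
  is nonnegative, the induction hypothesis may be squared.\<close>

lemma quadratic_form_pow_ge:
  fixes T :: "real mat"
  assumes T: "T \<in> carrier_mat n n" and sym: "transpose_mat T = T"
    and x: "x \<in> carrier_vec n" and pos: "0 < x \<bullet> x"
    and r: "0 \<le> r" "r * (x \<bullet> x) \<le> x \<bullet> (T *\<^sub>v x)"
  shows "r ^ (2 ^ k) * (x \<bullet> x) \<le> x \<bullet> ((T ^\<^sub>m (2 ^ k)) *\<^sub>v x)"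
proof (induction k)
  case 0
  then show ?case using r T by simp
next
  case (Suc k)
  define B where "B = T ^\<^sub>m (2 ^ k)"
  have B: "B \<in> carrier_mat n n"
    using T by (simp add: B_def)
  have Bx: "B *\<^sub>v x \<in> carrier_vec n"
    using B x by simp
  have "T ^\<^sub>m (2 ^ Suc k) = B * B"
    unfolding B_def pow_mat_add[OF T, symmetric] by (simp add: mult_2)
  then have "x \<bullet> ((T ^\<^sub>m (2 ^ Suc k)) *\<^sub>v x) = x \<bullet> (B *\<^sub>v (B *\<^sub>v x))"
    using B x by (simp add: assoc_mult_mat_vec[of _ n n _ n])
  also have "\<dots> = (B *\<^sub>v x) \<bullet> (B *\<^sub>v x)"
    using transpose_vec_mult_scalar[OF B Bx x] transpose_pow_mat_symmetric[OF T sym]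
    by (simp add: B_def)
  finally have eq: "x \<bullet> ((T ^\<^sub>m (2 ^ Suc k)) *\<^sub>v x) = (B *\<^sub>v x) \<bullet> (B *\<^sub>v x)" .
  have "(r ^ (2 ^ k) * (x \<bullet> x))\<^sup>2 \<le> (x \<bullet> (B *\<^sub>v x))\<^sup>2"
    using Suc r(1) pos by (intro power_mono) (auto simp: B_def)
  also have "\<dots> \<le> (x \<bullet> x) * ((B *\<^sub>v x) \<bullet> (B *\<^sub>v x))"
    by (rule scalar_prod_Cauchy_Schwarz[OF x Bx])
  finally have "(x \<bullet> x) * (r ^ (2 ^ Suc k) * (x \<bullet> x)) \<le> (x \<bullet> x) * ((B *\<^sub>v x) \<bullet> (B *\<^sub>v x))"
    by (simp add: power_mult_distrib power2_eq_square power_mult mult_ac)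
  then show ?case
    unfolding eq using pos by simp
qed

lemma quadratic_form_le_of_bounded_powers:
  fixes T :: "real mat"
  assumes T: "T \<in> carrier_mat n n" and sym: "transpose_mat T = T"
    and x: "x \<in> carrier_vec n"
    and K: "\<And>k i j. i < n \<Longrightarrow> j < n \<Longrightarrow> \<bar>(T ^\<^sub>m k) $$ (i, j)\<bar> \<le> K"
  shows "x \<bullet> (T *\<^sub>v x) \<le> x \<bullet> x"
proof (rule ccontr)
  assume "\<not> ?thesis"
  then have less: "x \<bullet> x < x \<bullet> (T *\<^sub>v x)"
    by simp
  define M where "M = (\<Sum>i\<in>{0..<n}. \<Sum>j\<in>{0..<n}. \<bar>x $ i\<bar> * (K * \<bar>x $ j\<bar>))"
  \<comment> \<open>If x'x were 0, Cauchy-Schwarz would force x'Tx = 0 as well, against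
    \<open>less\<close>.\<close>
  have pos: "0 < x \<bullet> x"
  proof (rule ccontr)
    assume "\<not> 0 < x \<bullet> x"
    then have "x \<bullet> x = 0"
      using scalar_prod_self_nonneg[of x] by simp
    then have "x \<bullet> (T *\<^sub>v x) = 0"
      using scalar_prod_Cauchy_Schwarz[OF x, of "T *\<^sub>v x"] T x by simp
    then show False
      using less \<open>x \<bullet> x = 0\<close> by simp
  qed
  define r where "r = (x \<bullet> (T *\<^sub>v x)) / (x \<bullet> x)"
  have r: "1 < r" "r * (x \<bullet> x) = x \<bullet> (T *\<^sub>v x)"
    using less pos by (auto simp: r_def)
  \<comment> \<open>The Archimedean property gives an exponent k, while the lower bound holds only
    for powers of two. As r > 1 and k < 2^k, passing to 2^k only enlarges the power.\<close>
  obtain k where k: "M / (x \<bullet> x) < r ^ k"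
    using real_arch_pow[OF r(1)] by blast
  also have "r ^ k \<le> r ^ (2 ^ k)"
    using r(1) by (intro power_increasing) (auto intro: less_imp_le[OF less_exp])
  finally have "M < r ^ (2 ^ k) * (x \<bullet> x)"
    using pos by (simp add: field_simps)
  also have "\<dots> \<le> x \<bullet> ((T ^\<^sub>m (2 ^ k)) *\<^sub>v x)"
    using r by (intro quadratic_form_pow_ge[OF T sym x pos]) auto
  also have "\<dots> \<le> M"
    unfolding M_def using T x K by (intro quadratic_form_bound) auto
  finally show False by simp
qed

section \<open>Spectral radius and Rayleigh quotient\<close>

lemma spectral_radius_smult_less_1:
  assumes A: "A \<in> carrier_mat n n" and n: "0 < n"
    and c: "0 < c" "spectral_radius A < c"
  shows "spectral_radius (complex_of_real (1 / c) \<cdot>\<^sub>m A) < 1"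
proof -
  let ?B = "complex_of_real (1 / c) \<cdot>\<^sub>m A"
  have B: "?B \<in> carrier_mat n n"
    using A by simp
  obtain e where e: "eigenvalue ?B e" and sr: "spectral_radius ?B = cmod e"
    using spectral_radius_mem_max(1)[OF B n] by (auto simp: spectrum_def)
  then obtain v where v: "v \<in> carrier_vec n" "v \<noteq> 0\<^sub>v n" and ev: "?B *\<^sub>v v = e \<cdot>\<^sub>v v"
    using B A by (auto simp: eigenvalue_def eigenvector_def)
  have "A *\<^sub>v v = (of_real c * e) \<cdot>\<^sub>v v"
  proof (rule eq_vecI)
    fix i assume "i < dim_vec ((of_real c * e) \<cdot>\<^sub>v v)"
    then have i: "i < n" using v by simp
    have "(?B *\<^sub>v v) $ i = e * v $ i"
      unfolding ev using i v by simp
    then show "(A *\<^sub>v v) $ i = ((of_real c * e) \<cdot>\<^sub>v v) $ i"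
      using i A v c(1) by (simp add: field_simps)
  qed (use A v in auto)
  then have "of_real c * e \<in> spectrum A"
    using A v unfolding spectrum_def eigenvalue_def eigenvector_def by auto
  then have "cmod (of_real c * e) \<le> spectral_radius A"
    by (intro spectral_radius_mem_max(2)[OF A n]) auto
  then have "c * cmod e \<le> spectral_radius A"
    using c(1) by (simp add: norm_mult)
  then have "c * cmod e < c * 1"
    using c(2) by linarith
  then show ?thesis
    unfolding sr mult_less_cancel_left_pos[OF c(1)] .
qed

lemma real_spectral_radius_nonneg:
  assumes A: "A \<in> carrier_mat n n" and n: "0 < n"
  shows "0 \<le> real_spectral_radius A"
proof -
  have "map_mat complex_of_real A \<in> carrier_mat n n"
    using A by simp
  from spectral_radius_mem_max(1)[OF this n] show ?thesis
    unfolding real_spectral_radius_def by auto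
qed

lemma symmetric_quadratic_form_le:
  fixes S :: "real mat"
  assumes S: "S \<in> carrier_mat n n" and sym: "transpose_mat S = S"
    and x: "x \<in> carrier_vec n" and n: "0 < n"
  shows "x \<bullet> (S *\<^sub>v x) \<le> real_spectral_radius S * (x \<bullet> x)"
proof -
  \<comment> \<open>A strict excess of c makes the spectral radius of S / c strictly less than 1,
    which ensures bounded powers; at radius exactly 1 a general matrix may have unbounded
    ones.\<close>
  have le: "x \<bullet> (S *\<^sub>v x) \<le> c * (x \<bullet> x)" if c: "real_spectral_radius S < c" for c
  proof -
    have c0: "0 < c"
      using c real_spectral_radius_nonneg[OF S n] by simp
    define T where "T = (1 / c) \<cdot>\<^sub>m S"
    have T: "T \<in> carrier_mat n n"
      using S by (simp add: T_def)
    have symT: "transpose_mat T = T"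
    proof -
      have "transpose_mat T = (1 / c) \<cdot>\<^sub>m transpose_mat S"
        unfolding T_def by (rule eq_matI) auto
      then show ?thesis
        by (simp add: sym T_def)
    qed
    let ?TC = "map_mat complex_of_real T"
    have TC: "?TC \<in> carrier_mat n n"
      using T by simp
    have "?TC = complex_of_real (1 / c) \<cdot>\<^sub>m map_mat complex_of_real S"
      unfolding T_def by (rule eq_matI) auto
    then have "spectral_radius ?TC < 1"
      using spectral_radius_smult_less_1[of "map_mat complex_of_real S" n c] S n c c0
      by (simp add: real_spectral_radius_def)
    from spectral_radius_jnf_norm_bound_less_1_upper_triangular[OF TC this]
    obtain K where K: "\<And>k. norm_bound (?TC ^\<^sub>m k) K"
      by blast
    \<comment> \<open>The complex bound descends to T because the embedding of the reals commutes
      with powers and preserves absolute values.\<close>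
    have "\<bar>(T ^\<^sub>m k) $$ (i, j)\<bar> \<le> K" if "i < n" "j < n" for k i j
      using K[of k, folded of_real_hom.mat_hom_pow[OF T]] that T
      by (simp add: norm_bound_def)
    then have "x \<bullet> (T *\<^sub>v x) \<le> x \<bullet> x"
      by (intro quadratic_form_le_of_bounded_powers[OF T symT x])
    moreover have "x \<bullet> (T *\<^sub>v x) = x \<bullet> (S *\<^sub>v x) / c"
      using S x by (simp add: T_def scalar_prod_def sum_distrib_left sum_divide_distrib)
    ultimately show ?thesis
      using c0 by (simp add: field_simps)
  qed
  show ?thesis
  proof (cases "x \<bullet> x = 0")
    case True
    \<comment> \<open>Any c above the spectral radius will do, since c * (x'x) is 0.\<close>
    then show ?thesis
      using le[OF less_add_one] by simp
  next
    case False
    then have pos: "0 < x \<bullet> x"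
      using scalar_prod_self_nonneg[of x] by simp
    have "(x \<bullet> (S *\<^sub>v x)) / (x \<bullet> x) \<le> real_spectral_radius S"
      \<comment> \<open>Letting c decrease to the spectral radius turns the bounds for all larger c
        into the bound at the radius itself.\<close>
      by (rule dense_ge) (use le pos in \<open>simp add: field_simps\<close>)
    then show ?thesis
      using pos by (simp add: field_simps)
  qed
qed

section \<open>Nonnegative matrices and their symmetric parts\<close>

lemma quadratic_form_symmetric_part:
  fixes A :: "real mat"
  assumes A: "A \<in> carrier_mat n n" and x: "x \<in> carrier_vec n"
  shows "x \<bullet> (((1 / 2) \<cdot>\<^sub>m (A + transpose_mat A)) *\<^sub>v x) = x \<bullet> (A *\<^sub>v x)"
proof -
  let ?q = "\<lambda>i j. x $ i * (A $$ (i, j) * x $ j)"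
  have q: "x \<bullet> (A *\<^sub>v x) = (\<Sum>i\<in>{0..<n}. \<Sum>j\<in>{0..<n}. ?q i j)"
    using A x by (simp add: scalar_prod_def sum_distrib_left)
  have "x \<bullet> (((1 / 2) \<cdot>\<^sub>m (A + transpose_mat A)) *\<^sub>v x)
      = (\<Sum>i\<in>{0..<n}. \<Sum>j\<in>{0..<n}. (1 / 2) * (?q i j + ?q j i))"
    using A x by (simp add: scalar_prod_def sum_distrib_left algebra_simps)
  also have "\<dots> = (1 / 2) * (x \<bullet> (A *\<^sub>v x) + (\<Sum>i\<in>{0..<n}. \<Sum>j\<in>{0..<n}. ?q j i))"
    unfolding q by (simp only: sum.distrib flip: sum_distrib_left)
  also have "(\<Sum>i\<in>{0..<n}. \<Sum>j\<in>{0..<n}. ?q j i) = x \<bullet> (A *\<^sub>v x)"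
    unfolding q by (rule sum.swap)
  finally show ?thesis by simp
qed

lemma nonneg_real_spectral_radius_le_symmetric_part:
  fixes A :: "real mat"
  assumes A: "A \<in> carrier_mat n n" and n: "0 < n"
    and nonneg: "\<And>i j. i < n \<Longrightarrow> j < n \<Longrightarrow> 0 \<le> A $$ (i, j)"
  shows "real_spectral_radius A \<le> real_spectral_radius ((1 / 2) \<cdot>\<^sub>m (A + transpose_mat A))"
proof -
  let ?S = "(1 / 2) \<cdot>\<^sub>m (A + transpose_mat A)"
  let ?AC = "map_mat complex_of_real A"
  have AC: "?AC \<in> carrier_mat n n"
    using A by simp
  obtain e where "eigenvalue ?AC e" and sr: "real_spectral_radius A = cmod e"
    using spectral_radius_mem_max(1)[OF AC n]
    by (auto simp: spectrum_def real_spectral_radius_def)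
  then obtain z where z: "z \<in> carrier_vec n" "z \<noteq> 0\<^sub>v n" and ev: "?AC *\<^sub>v z = e \<cdot>\<^sub>v z"
    using A by (auto simp: eigenvalue_def eigenvector_def)
  define y where "y = vec n (\<lambda>i. cmod (z $ i))"
  have y: "y \<in> carrier_vec n"
    by (simp add: y_def)
  \<comment> \<open>The triangle inequality is applied to row i of the eigenvector equation; the
    entries of A are their own absolute values.\<close>
  have "cmod e * y $ i \<le> (A *\<^sub>v y) $ i" if i: "i < n" for i
  proof -
    have "cmod e * y $ i = cmod ((?AC *\<^sub>v z) $ i)"
      unfolding ev using i z by (simp add: y_def norm_mult)
    also have "\<dots> = cmod (\<Sum>j\<in>{0..<n}. of_real (A $$ (i, j)) * z $ j)"
      using i A z by (simp add: scalar_prod_def)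
    also have "\<dots> \<le> (\<Sum>j\<in>{0..<n}. cmod (of_real (A $$ (i, j)) * z $ j))"
      by (rule norm_sum)
    also have "\<dots> = (A *\<^sub>v y) $ i"
      using i A nonneg by (simp add: scalar_prod_def y_def norm_mult)
    finally show ?thesis .
  qed
  \<comment> \<open>Weighting row i by the nonnegative number y_i and summing yields quadratic forms
    on both sides.\<close>
  then have "(\<Sum>i\<in>{0..<n}. y $ i * (cmod e * y $ i)) \<le> (\<Sum>i\<in>{0..<n}. y $ i * (A *\<^sub>v y) $ i)"
    by (intro sum_mono mult_left_mono) (auto simp: y_def)
  then have "cmod e * (y \<bullet> y) \<le> y \<bullet> (A *\<^sub>v y)"
    using A by (simp add: scalar_prod_def y_def sum_distrib_left mult_ac)
  also have "\<dots> = y \<bullet> (?S *\<^sub>v y)"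
    by (rule quadratic_form_symmetric_part[OF A y, symmetric])
  also have "\<dots> \<le> real_spectral_radius ?S * (y \<bullet> y)"
    using A y n by (intro symmetric_quadratic_form_le[of _ n] eq_matI) (auto simp: add.commute)
  finally have le: "cmod e * (y \<bullet> y) \<le> real_spectral_radius ?S * (y \<bullet> y)" .
  have "y \<bullet> y \<noteq> 0"
  proof
    assume "y \<bullet> y = 0"
    then have "\<forall>i\<in>{0..<n}. z $ i = 0"
      by (simp add: scalar_prod_def y_def sum_nonneg_eq_0_iff)
    then have "z = 0\<^sub>v n"
      using z(1) by (intro eq_vecI) auto
    with z(2) show False ..
  qed
  then have "0 < y \<bullet> y"
    using scalar_prod_self_nonneg[of y] by simp
  with le show ?thesis
    unfolding sr by simp
qed

section \<open>Nonnegativity of generalized Euclidean distance matrices\<close>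

lemma pos_semidef_two_point_nonneg:
  assumes L: "pos_semidef_mat n L" and i: "i < n" and j: "j < n"
  shows "0 \<le> a\<^sup>2 * L $$ (i, i) + b\<^sup>2 * L $$ (j, j) - a * b * (L $$ (i, j) + L $$ (j, i))"
proof -
  let ?x = "a \<cdot>\<^sub>v unit_vec n i + (- b) \<cdot>\<^sub>v unit_vec n j"
  have Lc: "L \<in> carrier_mat n n" and psd: "\<And>x. x \<in> carrier_vec n \<Longrightarrow> 0 \<le> x \<bullet> (L *\<^sub>v x)"
    using L by (auto simp: pos_semidef_mat_def)
  have x: "?x \<in> carrier_vec n"
    by simp
  have q: "?x \<bullet> w = a * w $ i - b * w $ j" if "w \<in> carrier_vec n" for w :: "real vec"
    using that i j by (simp add: add_scalar_prod_distrib[of _ n])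
  have row: "(L *\<^sub>v ?x) $ k = a * L $$ (k, i) - b * L $$ (k, j)" if "k < n" for k
  proof -
    have r: "row L k \<in> carrier_vec n"
      using that Lc by simp
    have "(L *\<^sub>v ?x) $ k = row L k \<bullet> ?x"
      using that Lc by simp
    also have "\<dots> = ?x \<bullet> row L k"
      by (rule comm_scalar_prod[OF r x])
    finally show ?thesis
      using q[OF r] that i j Lc by simp
  qed
  have "0 \<le> ?x \<bullet> (L *\<^sub>v ?x)"
    by (rule psd[OF x])
  also have "\<dots> = a * (a * L $$ (i, i) - b * L $$ (i, j)) - b * (a * L $$ (j, i) - b * L $$ (j, j))"
    using Lc x i j by (subst q) (auto simp: row simp del: index_mult_mat_vec)
  finally show ?thesis
    by (simp add: algebra_simps power2_eq_square)
qed

lemma generalized_EDM_nonneg: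
  assumes D: "generalized_EDM n D" and i: "i < n" and j: "j < n"
  shows "0 \<le> D $$ (i, j)"
proof -
  obtain a b L where Dij: "D $$ (i, j) = a\<^sup>2 * L $$ (i, i) + b\<^sup>2 * L $$ (j, j) - 2 * a * b * L $$ (i, j)"
    and "generalized_laplacian n L"
    using D i j unfolding generalized_EDM_def by blast
  then have Lc: "L \<in> carrier_mat n n" and sym: "transpose_mat L = L" and psd: "pos_semidef_mat n L"
    unfolding generalized_laplacian_def by blast+
  \<comment> \<open>Symmetry merges the two mixed terms of the quadratic form into the single term
    2ab L_ij of the definition.\<close>
  have "L $$ (j, i) = L $$ (i, j)"
    using index_transpose_mat(1)[of i L j] Lc i j unfolding sym by simp
  then show ?thesis
    using pos_semidef_two_point_nonneg[OF psd i j, of a b] by (simp add: Dij)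
qed

theorem corollary2p22:
  fixes n :: nat and D :: "real mat"
  assumes "generalized_EDM n D"
    and "D \<noteq> 0\<^sub>m n n"
  shows "real_spectral_radius D \<le> real_spectral_radius ((1 / 2) \<cdot>\<^sub>m (D + transpose_mat D))"
proof (rule nonneg_real_spectral_radius_le_symmetric_part)
  show D: "D \<in> carrier_mat n n"
    using assms(1) by (simp add: generalized_EDM_def)
  show "0 < n"
    \<comment> \<open>The only 0 x 0 matrix is the zero matrix, so a non-zero D excludes the case of
      an empty spectrum.\<close>
    using assms(2) D by (cases n) auto
  show "0 \<le> D $$ (i, j)" if "i < n" "j < n" for i j
    using generalized_EDM_nonneg[OF assms(1) that] .
qed

end
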